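(* Let $\{x_t\}$, $x_t=[x_{i,t}]_{i=1}^p$, be random variables on a common probability space. (a) If $p>e$ and $p=o(\bar{\mathbb{P}}_{\mathcal{M}_n}^{-1})$ then $$\mathbb{P}\left(\max_i|\bar x_{i,n}|>\mathcal{M}_n\right)\le2\frac{\ln(p)}{\ln\bar{\mathbb{P}}_{\mathcal{M}_n}^{-1}}\to0.$$ (b) If the $x_{i,t}$ are $\mathcal{L}_q$-bounded, $q\ge1$, $\max_i\|\bar x_{i,n}\|_q=o(\mathcal{M}_n)$, and $p=o(\mathcal{M}_n^q/\max_i\mathbb{E}|\bar x_{i,n}|^q)$, then $$\mathbb{P}\left(\max_i|\bar x_{i,n}|>\mathcal{M}_n\right)\le2\frac{\ln(p)}{\ln\left(\mathcal{M}_n^q/\max_i\mathbb{E}|\bar x_{i,n}|^q\right)}\to0.$$ (c) If $\max_i\mathbb{P}(|\bar x_{i,n}|\ge c)\le a\exp\{-bn^\gamma c^\gamma\}$ for some $(a,b,\gamma)>0$ and all $c>0$, then for any $\phi\in(0,\gamma)$, $p>e$ and $\ln(p)=o(n^\phi\mathcal{M}_n^\phi)$, $$\mathbb{P}\left(\max_i|\bar x_{i,n}|\ge\mathcal{M}_n\right)\le\frac{\ln(p)}{n^\phi\mathcal{M}_n^\phi\ln(\ln p)}+a\frac{(\ln(p))^{n^\phi\mathcal{M}_n^\phi}}{n^\phi\mathcal{M}_n^\phi\exp\{bn^\gamma\mathcal{M}_n^\gamma\}\ln(\ln p)}\to0.$$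
   Context: $\max_i=\max_{1\le i\le p}$; $p=p_n$ may depend on $n$; $\bar x_{i,n}:=\frac1n\sum_{t=1}^nx_{i,t}$; $\|\cdot\|_q$ is the $\mathcal{L}_q$-norm and $\mathcal{L}_q$-bounded means $\mathbb{E}|x_{i,t}|^q<\infty$. $\{\mathcal{M}_n\}$ is a monotonically increasing sequence of positive reals with $\mathcal{M}_n\to\infty$, and $\bar{\mathbb{P}}_{\mathcal{M}}:=\max_i\mathbb{P}(|\bar x_{i,n}|>\mathcal{M})$. Limits and $o(\cdot)$ are as $n\to\infty$.
   Formalization: In (a),(b) the bound need not tend to 0 as claimed: the inequality is proved where the log is positive (all large n), the probability tends to 0, and the bound tends to 0 if p=o(Q^ε) for every ε>0, Q being the quantity inside the log. (b) also assumes p≥2, as the bound is 0 at p=1. *)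

theory Defs
  imports "HOL-Probability.Probability"
begin

text \<open>
  The array is given as \<open>x i t \<omega>\<close> with coordinate \<open>i \<ge> 1\<close> and time \<open>t \<ge> 1\<close>; at sample size
  \<open>n \<ge> 1\<close> only the coordinates \<open>i \<in> {1..p n}\<close> are in use.
\<close>

definition sample_mean :: "(nat \<Rightarrow> nat \<Rightarrow> 'a \<Rightarrow> real) \<Rightarrow> nat \<Rightarrow> nat \<Rightarrow> 'a \<Rightarrow> real" where
  "sample_mean x i n \<omega> = 1 / real n * (\<Sum>t=1..n. x i t \<omega>)"

definition Lq_norm :: "'a measure \<Rightarrow> real \<Rightarrow> ('a \<Rightarrow> real) \<Rightarrow> real" where
  "Lq_norm \<Omega> q f = (\<integral>\<omega>. \<bar>f \<omega>\<bar> powr q \<partial>\<Omega>) powr (1 / q)"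

definition max_tail_prob ::
    "'a measure \<Rightarrow> (nat \<Rightarrow> nat \<Rightarrow> 'a \<Rightarrow> real) \<Rightarrow> (nat \<Rightarrow> nat) \<Rightarrow> nat \<Rightarrow> real \<Rightarrow> real" where
  "max_tail_prob \<Omega> x p n c =
     (MAX i\<in>{1..p n}. measure \<Omega> {\<omega> \<in> space \<Omega>. \<bar>sample_mean x i n \<omega>\<bar> > c})"

definition max_moment ::
    "'a measure \<Rightarrow> (nat \<Rightarrow> nat \<Rightarrow> 'a \<Rightarrow> real) \<Rightarrow> (nat \<Rightarrow> nat) \<Rightarrow> real \<Rightarrow> nat \<Rightarrow> real" where
  "max_moment \<Omega> x p q n =
     (MAX i\<in>{1..p n}. \<integral>\<omega>. \<bar>sample_mean x i n \<omega>\<bar> powr q \<partial>\<Omega>)"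

text \<open>
  The quotient form of \<open>f = o(g)\<close>. It is used where \<open>g\<close> is a reciprocal \<open>c / d\<close> whose
  denominator may vanish: mathematically \<open>g n = \<infinity>\<close> and \<open>f n / g n = 0\<close> there, which agrees with
  the convention \<open>c / 0 = 0\<close> in HOL. The Landau symbol of the library would instead force
  \<open>f n = 0\<close> at such \<open>n\<close>. If \<open>g\<close> has no zeros the two notions coincide.
  Likewise the bounds \<open>2 * ln p / ln (c / d)\<close> take their limiting value \<open>0\<close> at \<open>d = 0\<close>,
  because \<open>ln 0 = 0\<close> in HOL.
\<close>

definition small_o_quotient :: "(nat \<Rightarrow> real) \<Rightarrow> (nat \<Rightarrow> real) \<Rightarrow> bool" where
  "small_o_quotient f g \<longleftrightarrow> (\<lambda>n. f n / g n) \<longlonglongrightarrow> 0"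

end

theory Submission
  imports Defs "HOL-Real_Asymp.Real_Asymp"
begin

text \<open>
  Everything rests on the union bound \<open>u \<le> p * R\<close> for \<open>u = P(max\<^sub>i |\<dots>| > M)\<close>, where \<open>R\<close>
  dominates the individual tail probabilities (by Markov's inequality in (b)). For (a) and (b) put
  \<open>Q = 1 / R\<close> and \<open>L = ln Q\<close>: if \<open>L \<le> 2 ln p\<close> the asserted bound is at least \<open>1\<close>, and otherwise
  \<open>p / Q * L \<le> L exp (-L / 2) \<le> 1 \<le> 2 ln p\<close>. For (c), convexity of the exponential gives
  \<open>y powr u \<le> 1 + u * (y - 1)\<close>, so \<open>u ln y \<le> ln p + R y\<close>; take \<open>y = (ln p) powr A\<close> with
  \<open>A = (n M) powr \<phi>\<close>. The bound vanishes because \<open>ln p \<le> A\<close> eventually and \<open>A ln A\<close> is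
  negligible against \<open>A powr (\<gamma> / \<phi>) = (n M) powr \<gamma>\<close>.
\<close>

section \<open>Union bound for the tail of a finite maximum\<close>

lemma (in finite_measure) measure_UN_le_card_mult_Max:
  assumes "finite I" and "\<And>i. i \<in> I \<Longrightarrow> A i \<in> sets M"
  shows "measure M (\<Union>i\<in>I. A i) \<le> real (card I) * (MAX i\<in>I. measure M (A i))"
proof -
  have "measure M (\<Union>i\<in>I. A i) \<le> (\<Sum>i\<in>I. measure M (A i))"
    using assms by (intro finite_measure_subadditive_finite) auto
  also have "\<dots> \<le> real (card I) * (MAX i\<in>I. measure M (A i))"
    using assms by (intro sum_bounded_above) auto
  finally show ?thesis .
qed

lemma (in finite_measure) measure_Max_greater_le:
  fixes f :: "'i \<Rightarrow> 'a \<Rightarrow> real"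
  assumes "finite I" "I \<noteq> {}" and [measurable]: "\<And>i. i \<in> I \<Longrightarrow> f i \<in> borel_measurable M"
  shows "measure M {\<omega> \<in> space M. (MAX i\<in>I. f i \<omega>) > c}
    \<le> real (card I) * (MAX i\<in>I. measure M {\<omega> \<in> space M. f i \<omega> > c})"
proof -
  have "{\<omega> \<in> space M. (MAX i\<in>I. f i \<omega>) > c} = (\<Union>i\<in>I. {\<omega> \<in> space M. f i \<omega> > c})"
    using assms(1,2) by (auto simp: Max_gr_iff)
  then show ?thesis
    using assms(1) by (simp, intro measure_UN_le_card_mult_Max) auto
qed

lemma (in finite_measure) measure_Max_ge_le:
  fixes f :: "'i \<Rightarrow> 'a \<Rightarrow> real"
  assumes "finite I" "I \<noteq> {}" and [measurable]: "\<And>i. i \<in> I \<Longrightarrow> f i \<in> borel_measurable M"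
  shows "measure M {\<omega> \<in> space M. (MAX i\<in>I. f i \<omega>) \<ge> c}
    \<le> real (card I) * (MAX i\<in>I. measure M {\<omega> \<in> space M. f i \<omega> \<ge> c})"
proof -
  have "{\<omega> \<in> space M. (MAX i\<in>I. f i \<omega>) \<ge> c} = (\<Union>i\<in>I. {\<omega> \<in> space M. f i \<omega> \<ge> c})"
    using assms(1,2) by (auto simp: Max_ge_iff)
  then show ?thesis
    using assms(1) by (simp, intro measure_UN_le_card_mult_Max) auto
qed

section \<open>Sample means: integrability and Markov's inequality\<close>

lemma borel_measurable_sample_mean [measurable]:
  assumes "\<And>t. t \<in> {1..n} \<Longrightarrow> x i t \<in> borel_measurable N"
  shows "sample_mean x i n \<in> borel_measurable N"
  using assms unfolding sample_mean_def by measurable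

text \<open>If every summand were smaller in modulus than the mean, the triangle inequality would be
  violated, so one summand dominates the mean. The estimate is crude, but it only has to supply an
  integrable majorant.\<close>

lemma abs_sample_mean_powr_le:
  assumes "n \<ge> 1" "q \<ge> 0"
  shows "\<bar>sample_mean x i n \<omega>\<bar> powr q \<le> (\<Sum>t=1..n. \<bar>x i t \<omega>\<bar> powr q)"
proof -
  have "\<exists>t\<in>{1..n}. \<bar>sample_mean x i n \<omega>\<bar> \<le> \<bar>x i t \<omega>\<bar>"
  proof (rule ccontr)
    assume *: "\<not> ?thesis"
    have "\<bar>\<Sum>t=1..n. x i t \<omega>\<bar> \<le> (\<Sum>t=1..n. \<bar>x i t \<omega>\<bar>)"
      by (rule sum_abs)
    also have "\<dots> < (\<Sum>t=1..n. \<bar>sample_mean x i n \<omega>\<bar>)"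
      using * assms by (intro sum_strict_mono) (auto simp: not_le)
    also have "\<dots> = \<bar>\<Sum>t=1..n. x i t \<omega>\<bar>"
      using assms by (simp add: sample_mean_def abs_mult)
    finally show False by simp
  qed
  then obtain t where t: "t \<in> {1..n}" "\<bar>sample_mean x i n \<omega>\<bar> \<le> \<bar>x i t \<omega>\<bar>" by auto
  have "\<bar>sample_mean x i n \<omega>\<bar> powr q \<le> \<bar>x i t \<omega>\<bar> powr q"
    using t assms by (intro powr_mono2) auto
  also have "\<dots> \<le> (\<Sum>t=1..n. \<bar>x i t \<omega>\<bar> powr q)"
    using t by (intro member_le_sum) auto
  finally show ?thesis .
qed

lemma integrable_abs_sample_mean_powr:
  assumes "n \<ge> 1" "q \<ge> 0"
    and [measurable]: "\<And>t. t \<in> {1..n} \<Longrightarrow> x i t \<in> borel_measurable N"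
    and int: "\<And>t. t \<in> {1..n} \<Longrightarrow> integrable N (\<lambda>\<omega>. \<bar>x i t \<omega>\<bar> powr q)"
  shows "integrable N (\<lambda>\<omega>. \<bar>sample_mean x i n \<omega>\<bar> powr q)"
proof (rule Bochner_Integration.integrable_bound)
  show "integrable N (\<lambda>\<omega>. \<Sum>t=1..n. \<bar>x i t \<omega>\<bar> powr q)"
    using int by auto
  have [measurable]: "sample_mean x i n \<in> borel_measurable N"
    using assms(3) by (rule borel_measurable_sample_mean)
  show "(\<lambda>\<omega>. \<bar>sample_mean x i n \<omega>\<bar> powr q) \<in> borel_measurable N" by measurable
  show "AE \<omega> in N. norm (\<bar>sample_mean x i n \<omega>\<bar> powr q)
      \<le> norm (\<Sum>t=1..n. \<bar>x i t \<omega>\<bar> powr q)"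
    using abs_sample_mean_powr_le[OF assms(1,2), of x i]
    by (auto intro!: AE_I2 simp: order_trans[OF _ abs_ge_self])
qed

text \<open>Markov's inequality at level \<open>c powr q\<close>. Integrability matters: the Bochner
  integral of a nonintegrable function is 0, and the bound could then fail.\<close>

lemma (in finite_measure) measure_abs_greater_le_moment:
  fixes f :: "'a \<Rightarrow> real"
  assumes "c > 0" "q > 0" and [measurable]: "f \<in> borel_measurable M"
    and "integrable M (\<lambda>\<omega>. \<bar>f \<omega>\<bar> powr q)"
  shows "measure M {\<omega> \<in> space M. \<bar>f \<omega>\<bar> > c} \<le> (\<integral>\<omega>. \<bar>f \<omega>\<bar> powr q \<partial>M) / c powr q"
proof -
  have "measure M {\<omega> \<in> space M. \<bar>f \<omega>\<bar> > c} \<le> measure M {\<omega> \<in> space M. \<bar>f \<omega>\<bar> powr q \<ge> c powr q}"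
    using assms(1,2) by (intro finite_measure_mono) (auto intro!: powr_mono2)
  also have "\<dots> \<le> (\<integral>\<omega>. \<bar>f \<omega>\<bar> powr q \<partial>M) / c powr q"
    using assms by (intro integral_Markov_inequality_measure[where A = "{}"]) auto
  finally show ?thesis .
qed

section \<open>Logarithmic ratio bound for (a) and (b)\<close>

text \<open>Here and below \<open>Q = 0\<close> stands for \<open>Q = \<infinity>\<close>, in line with \<open>c / 0 = 0\<close>.\<close>

lemma le_ln_ratio:
  fixes p Q u :: real
  assumes "p \<ge> 2" "Q = 0 \<or> Q > 1" "u \<le> 1" "u \<le> p / Q"
  shows "u \<le> 2 * (ln p / ln Q)"
proof (cases "Q = 0")
  \<comment> \<open>In HOL \<open>p / 0 = 0\<close> and \<open>ln 0 = 0\<close>, so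
    \<open>u \<le> 0\<close> and the right side is 0.\<close>
  case True
  then show ?thesis using assms by simp
next
  case False
  define L where "L = ln Q"
  have Q: "Q = exp L" and L: "L > 0"
    using False assms(2) by (auto simp: L_def)
  \<comment> \<open>The lower bound on \<open>p\<close> enters here: \<open>2 * ln p \<ge> 1\<close>
    is what closes the case of large \<open>L\<close>, where \<open>u * L\<close> is shown to be at
    most 1.\<close>
  have "- ln p \<le> 1 / p - 1"
    using ln_le_minus_one[of "1 / p"] assms(1) by (simp add: ln_div)
  moreover have "1 / p \<le> 1 / 2"
    using assms(1) by simp
  ultimately have lnp: "2 * ln p \<ge> 1"
    by linarith
  have "u * L \<le> 2 * ln p"
  proof (cases "L \<le> 2 * ln p")
    case True
    have "u * L \<le> 1 * L"
      using L assms(3) by (intro mult_right_mono) auto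
    with True show ?thesis by simp
  next
    case False
    then have "exp (ln p) \<le> exp (L / 2)" by simp
    then have "p \<le> exp (L / 2)"
      using assms(1) by simp
    \<comment> \<open>The quadratic Taylor minorant of \<open>exp (L / 2)\<close> exceeds
      \<open>L\<close> by half a square plus 1/2.\<close>
    moreover have "L \<le> exp (L / 2)"
    proof -
      have "1 + L / 2 + (L / 2)\<^sup>2 / 2 \<le> exp (L / 2)"
        using L by (intro exp_lower_Taylor_quadratic) auto
      moreover have "1 + L / 2 + (L / 2)\<^sup>2 / 2 - L = (L / 2 - 1)\<^sup>2 / 2 + 1 / 2"
        by (simp add: power2_eq_square field_simps)
      moreover have "(L / 2 - 1)\<^sup>2 \<ge> 0" by simp
      ultimately show ?thesis by linarith
    qed
    \<comment> \<open>One factor \<open>exp (L / 2)\<close> absorbs \<open>p\<close>, the other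
      absorbs \<open>L\<close>.\<close>
    ultimately have "p * L \<le> exp (L / 2) * exp (L / 2)"
      using L by (intro mult_mono) auto
    also have "\<dots> = Q" by (simp add: Q flip: exp_add)
    finally have "p / Q * L \<le> 1" by (simp add: Q)
    moreover have "u * L \<le> p / Q * L"
      using L assms(4) by (intro mult_right_mono) auto
    ultimately show ?thesis using lnp by linarith
  qed
  then show ?thesis using L by (simp add: L_def field_simps)
qed

text \<open>The quotient is eventually below 1, which says nothing where \<open>Q n = 0\<close>. It
  is applied to \<open>Q\<close> to make \<open>ln Q\<close> positive, and to
  \<open>Q powr \<epsilon>\<close> to compare \<open>ln p\<close> with
  \<open>\<epsilon> * ln Q\<close>.\<close>

lemma small_o_quotient_eventually_greater_one:
  assumes "small_o_quotient p Q" and "\<forall>\<^sub>F n in sequentially. p n \<ge> 1"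
    and "\<forall>\<^sub>F n in sequentially. Q n \<ge> 0"
  shows "\<forall>\<^sub>F n in sequentially. Q n = 0 \<or> Q n > p n"
proof -
  have "\<forall>\<^sub>F n in sequentially. p n / Q n < 1"
    using assms(1) unfolding small_o_quotient_def by (intro order_tendstoD) auto
  then show ?thesis
    using assms(2,3)
  proof eventually_elim
    case (elim n)
    then show ?case by (cases "Q n = 0") (auto simp: field_simps)
  qed
qed

text \<open>Eventually \<open>p n < Q n powr \<epsilon>\<close>, and taking logarithms puts the
  ratio below \<open>\<epsilon>\<close>. Every exponent is required: the single exponent 1 would
  only keep the ratio below 1.\<close>

lemma ln_ratio_tendsto_zero:
  fixes p Q :: "nat \<Rightarrow> real"
  assumes small: "\<forall>\<epsilon>>0. small_o_quotient p (\<lambda>n. Q n powr \<epsilon>)"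
    and p: "\<forall>\<^sub>F n in sequentially. p n \<ge> 1"
    and Q: "\<forall>\<^sub>F n in sequentially. Q n \<ge> 0"
  shows "(\<lambda>n. 2 * (ln (p n) / ln (Q n))) \<longlonglongrightarrow> 0"
proof -
  have "(\<lambda>n. ln (p n) / ln (Q n)) \<longlonglongrightarrow> 0"
  proof (rule tendstoI)
    fix \<epsilon> :: real assume \<epsilon>: "\<epsilon> > 0"
    have "\<forall>\<^sub>F n in sequentially. Q n powr \<epsilon> = 0 \<or> Q n powr \<epsilon> > p n"
      using small \<epsilon> p by (intro small_o_quotient_eventually_greater_one) auto
    with p Q show "\<forall>\<^sub>F n in sequentially. dist (ln (p n) / ln (Q n)) 0 < \<epsilon>"
    proof eventually_elim
      case (elim n)
      show ?case
      proof (cases "Q n = 0")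
        case True
        then show ?thesis using \<epsilon> by simp
      next
        case False
        then have "Q n > 0" using elim by simp
        with elim have *: "p n < Q n powr \<epsilon>" by auto
        then have "ln (p n) < ln (Q n powr \<epsilon>)"
          using elim by (intro ln_less_cancel_iff[THEN iffD2]) auto
        then have "ln (p n) < \<epsilon> * ln (Q n)"
          using \<open>Q n > 0\<close> by (simp add: ln_powr)
        moreover have "ln (p n) \<ge> 0" using elim by simp
        \<comment> \<open>A nonnegative \<open>ln (p n)\<close> below
          \<open>\<epsilon> * ln (Q n)\<close> forces the sign needed for the division.\<close>
        moreover from calculation have "ln (Q n) > 0"
          using \<epsilon> by (metis le_less_trans zero_less_mult_pos)
        ultimately show ?thesis by (simp add: field_simps)
      qed
    qed
  qed
  from tendsto_mult_left[OF this, of 2] show ?thesis by simp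
qed

text \<open>Common core of (a) and (b), which differ only in the choice of \<open>Q\<close>. The
  limit of \<open>u\<close> is read off from \<open>p / Q\<close>, since the logarithmic bound need
  not vanish under \<open>small\<close>.\<close>

lemma ln_ratio_bounds:
  fixes p Q u :: "nat \<Rightarrow> real"
  assumes small: "small_o_quotient p Q"
    and p: "\<forall>n\<ge>1. p n \<ge> 2" and Q: "\<forall>n\<ge>1. Q n \<ge> 0"
    and u: "\<And>n. u n \<ge> 0" "\<And>n. u n \<le> 1" "\<forall>n\<ge>1. u n \<le> p n / Q n"
  shows "\<And>n. n \<ge> 1 \<Longrightarrow> Q n = 0 \<or> Q n > 1 \<Longrightarrow> u n \<le> 2 * (ln (p n) / ln (Q n))"
    and "\<forall>\<^sub>F n in sequentially. Q n = 0 \<or> Q n > 1"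
    and "u \<longlonglongrightarrow> 0"
    and "\<forall>\<epsilon>>0. small_o_quotient p (\<lambda>n. Q n powr \<epsilon>) \<Longrightarrow>
      (\<lambda>n. 2 * (ln (p n) / ln (Q n))) \<longlonglongrightarrow> 0"
proof -
  have ev: "\<forall>\<^sub>F n in sequentially. p n \<ge> 1"
    using eventually_ge_at_top[of 1] by eventually_elim (use p in force)
  have evQ: "\<forall>\<^sub>F n in sequentially. Q n \<ge> 0"
    using eventually_ge_at_top[of 1] by eventually_elim (use Q in force)
  show "u n \<le> 2 * (ln (p n) / ln (Q n))" if "n \<ge> 1" "Q n = 0 \<or> Q n > 1" for n
    using that p u by (intro le_ln_ratio) auto
  show "\<forall>\<^sub>F n in sequentially. Q n = 0 \<or> Q n > 1"
    using small_o_quotient_eventually_greater_one[OF small ev evQ] ev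
    by eventually_elim auto
  show "u \<longlonglongrightarrow> 0"
  proof (rule tendsto_sandwich[OF _ _ tendsto_const])
    show "(\<lambda>n. p n / Q n) \<longlonglongrightarrow> 0"
      using small by (simp add: small_o_quotient_def)
    show "\<forall>\<^sub>F n in sequentially. u n \<le> p n / Q n"
      using eventually_ge_at_top[of 1] by eventually_elim (use u in auto)
  qed (use u in auto)
  show "(\<lambda>n. 2 * (ln (p n) / ln (Q n))) \<longlonglongrightarrow> 0"
    if "\<forall>\<epsilon>>0. small_o_quotient p (\<lambda>n. Q n powr \<epsilon>)"
    using that ev evQ by (rule ln_ratio_tendsto_zero)
qed

section \<open>Logarithmic bound under exponential tails for (c)\<close>

lemma mult_ln_le_ln_add:
  fixes u y p R :: real
  assumes "0 \<le> u" "u \<le> 1" "u \<le> p * R" "p \<ge> 1" "R \<ge> 0" "y \<ge> 1"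
  shows "u * ln y \<le> ln p + R * y"
proof -
  \<comment> \<open>The chord of \<open>exp\<close> between 0 and \<open>ln y\<close>, evaluated at
    \<open>u * ln y\<close>.\<close>
  have "exp ((1 - u) *\<^sub>R 0 + u *\<^sub>R ln y) \<le> (1 - u) * exp 0 + u * exp (ln y)"
    using assms by (intro convex_onD[OF exp_convex]) auto
  then have "exp (u * ln y) \<le> 1 + u * (y - 1)"
    using assms by (simp add: algebra_simps)
  also have "\<dots> \<le> 1 + p * R * (y - 1)"
    using assms by (intro add_left_mono mult_right_mono) auto
  \<comment> \<open>Enlarging 1 to \<open>p\<close> lets \<open>p\<close> factor out, so that the
    logarithm splits into \<open>ln p\<close> and a term free of \<open>p\<close>.\<close>
  also have "\<dots> \<le> p + p * R * y"
    using assms by (simp add: algebra_simps add_increasing2)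
  also have "\<dots> = p * (1 + R * y)" by (simp add: algebra_simps)
  finally have "u * ln y \<le> ln (p * (1 + R * y))"
    using assms by (subst ln_ge_iff) (auto intro!: mult_pos_pos add_pos_nonneg)
  also have "\<dots> = ln p + ln (1 + R * y)"
    using assms by (intro ln_mult_pos) (auto intro!: add_pos_nonneg)
  also have "\<dots> \<le> ln p + R * y"
    using assms by (intro add_left_mono ln_add_one_self_le_self) auto
  finally show ?thesis .
qed

text \<open>The choice \<open>y = ln p powr A\<close> gives \<open>ln y = A * ln (ln p)\<close>. The
  condition \<open>p > exp 1\<close> makes \<open>ln p > 1\<close>, hence \<open>y \<ge> 1\<close>
  and a positive divisor.\<close>

lemma le_log_exponential_bound:
  fixes u p R A :: real
  assumes "0 \<le> u" "u \<le> 1" "u \<le> p * R" "R \<ge> 0" "p > exp 1" "A > 0"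
  shows "u \<le> ln p / (A * ln (ln p)) + R * ln p powr A / (A * ln (ln p))"
proof -
  have p: "p > 0" using assms(5) by (meson exp_gt_zero less_trans)
  then have L: "ln p > 1" using assms(5) by (metis exp_less_cancel_iff exp_ln)
  then have LL: "ln (ln p) > 0" by simp
  have "p \<ge> 1" using assms(5) one_le_exp_iff[of "1::real"] by linarith
  then have "u * ln (ln p powr A) \<le> ln p + R * ln p powr A"
    using assms L by (intro mult_ln_le_ln_add) (auto intro!: ge_one_powr_ge_zero)
  then have "u * (A * ln (ln p)) \<le> ln p + R * ln p powr A"
    using L by (simp add: ln_powr)
  then show ?thesis
    using assms LL by (simp add: pos_le_divide_eq flip: add_divide_distrib)
qed

lemma powr_self_over_exp_tendsto_zero:
  fixes b s :: real
  assumes "b > 0" "s > 1"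
  shows "((\<lambda>A. A powr A / (A * exp (b * A powr s))) \<longlongrightarrow> 0) at_top"
  using assms by real_asymp

text \<open>Asking for \<open>p n \<ge> 3\<close> keeps \<open>ln (ln (p n))\<close> above the
  positive constant \<open>c\<close>; a real sequence that merely exceeds \<open>exp 1\<close> could
  let this divisor tend to 0.\<close>

lemma log_exponential_bound_tendsto_zero:
  fixes p A :: "nat \<Rightarrow> real"
  assumes p: "\<forall>\<^sub>F n in sequentially. p n \<ge> 3" and A: "filterlim A at_top sequentially"
    and small: "(\<lambda>n. ln (p n)) \<in> o(A)" and "a > 0" "b > 0" "s > 1"
  shows "(\<lambda>n. ln (p n) / (A n * ln (ln (p n)))
    + a * (ln (p n) powr A n / (A n * exp (b * A n powr s) * ln (ln (p n))))) \<longlonglongrightarrow> 0"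
proof -
  define c :: real where "c = ln (ln 3)"
  have "exp 1 < exp (ln (3::real))"
    using e_less_272 by simp
  then have ln3: "ln 3 > (1::real)"
    by (simp only: exp_less_cancel_iff)
  then have c: "c > 0" by (simp add: c_def)
  have ln_p: "ln (p n) > 1" "ln (ln (p n)) \<ge> c" if "p n \<ge> 3" for n
  proof -
    have "ln (p n) \<ge> ln 3" using that by simp
    then show "ln (p n) > 1" "ln (ln (p n)) \<ge> c"
      using ln3 unfolding c_def by (linarith, simp)
  qed
  have A1: "\<forall>\<^sub>F n in sequentially. A n \<ge> 1"
    using A by (simp add: filterlim_at_top)
  \<comment> \<open>Smallness with constant 1; it allows \<open>ln (p n) powr A n\<close> to be
    majorized by \<open>A n powr A n\<close>, which no longer involves \<open>p\<close>.\<close>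
  have le: "\<forall>\<^sub>F n in sequentially. ln (p n) \<le> A n"
    using landau_o.smallD[OF small zero_less_one] A1 by eventually_elim auto
  show ?thesis
  proof (rule tendsto_sandwich[OF _ _ tendsto_const])
    have "(\<lambda>n. ln (p n) / A n) \<longlonglongrightarrow> 0"
      using small by (rule smalloD_tendsto)
    moreover have "(\<lambda>n. A n powr A n / (A n * exp (b * A n powr s))) \<longlonglongrightarrow> 0"
      using powr_self_over_exp_tendsto_zero[OF assms(5,6)] A by (rule filterlim_compose)
    ultimately have "(\<lambda>n. ln (p n) / A n / c
        + a * (A n powr A n / (A n * exp (b * A n powr s))) / c) \<longlonglongrightarrow> 0 / c + a * 0 / c"
      using c by (intro tendsto_intros) auto
    then show "(\<lambda>n. ln (p n) / A n / c
        + a * (A n powr A n / (A n * exp (b * A n powr s))) / c) \<longlonglongrightarrow> 0" by simp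
    show "\<forall>\<^sub>F n in sequentially. ln (p n) / (A n * ln (ln (p n)))
        + a * (ln (p n) powr A n / (A n * exp (b * A n powr s) * ln (ln (p n))))
      \<le> ln (p n) / A n / c + a * (A n powr A n / (A n * exp (b * A n powr s))) / c"
      using p A1 le
    proof eventually_elim
      case (elim n)
      note L = ln_p[OF elim(1)]
      have "ln (p n) / A n / ln (ln (p n)) \<le> ln (p n) / A n / c"
        using L c elim by (intro divide_left_mono) auto
      moreover have "a * (ln (p n) powr A n / (A n * exp (b * A n powr s))) / ln (ln (p n))
          \<le> a * (A n powr A n / (A n * exp (b * A n powr s))) / c"
        using L c elim \<open>a > 0\<close>
        by (intro frac_le mult_left_mono divide_right_mono powr_mono2) auto
      ultimately show ?case by (simp add: mult.assoc)
    qed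
    show "\<forall>\<^sub>F n in sequentially. 0 \<le> ln (p n) / (A n * ln (ln (p n)))
        + a * (ln (p n) powr A n / (A n * exp (b * A n powr s) * ln (ln (p n))))"
      using p A1
    proof eventually_elim
      case (elim n)
      with ln_p[OF elim(1)] c \<open>a > 0\<close> show ?case by simp
    qed
  qed
qed

text \<open>Write \<open>Q\<close> for the argument of \<open>ln\<close> in the denominator in (a)
  and (b). The condition \<open>p = o(Q)\<close> does not make the bound vanish: for
  \<open>p = n\<close> and \<open>Q = n^2\<close> it is constantly 1. So the probability tends to 0
  under that condition, and the bound under \<open>p = o(Q powr \<epsilon>)\<close> for every
  \<open>\<epsilon> > 0\<close>. The pointwise guards exclude \<open>ln Q \<le> 0\<close> for
  positive \<open>Q\<close>, and (b) takes \<open>p n \<ge> 2\<close> because the bound is 0 at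
  \<open>p n = 1\<close>.\<close>

theorem lemma2p3:
  fixes \<Omega> :: "'a measure"
    and x :: "nat \<Rightarrow> nat \<Rightarrow> 'a \<Rightarrow> real"
    and p :: "nat \<Rightarrow> nat"
    and M :: "nat \<Rightarrow> real"
  assumes "prob_space \<Omega>"
    and "\<And>n i t. i \<in> {1..p n} \<Longrightarrow> t \<in> {1..n} \<Longrightarrow> x i t \<in> borel_measurable \<Omega>"
    and "\<And>n. n \<ge> 1 \<Longrightarrow> p n \<ge> 1"
    and "\<And>n. n \<ge> 1 \<Longrightarrow> M n > 0"
    and "mono_on {1..} M"
    and "filterlim M at_top sequentially"
  shows
    "((\<forall>n\<ge>1. real (p n) > exp 1) \<and>
      small_o_quotient (\<lambda>n. real (p n)) (\<lambda>n. 1 / max_tail_prob \<Omega> x p n (M n))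
      \<longrightarrow>
        (\<forall>n\<ge>1. max_tail_prob \<Omega> x p n (M n) < 1 \<longrightarrow>
           measure \<Omega> {\<omega> \<in> space \<Omega>. (MAX i\<in>{1..p n}. \<bar>sample_mean x i n \<omega>\<bar>) > M n}
             \<le> 2 * (ln (real (p n)) / ln (1 / max_tail_prob \<Omega> x p n (M n)))) \<and>
        (\<forall>\<^sub>F n in sequentially. max_tail_prob \<Omega> x p n (M n) < 1) \<and>
        (\<lambda>n. measure \<Omega> {\<omega> \<in> space \<Omega>. (MAX i\<in>{1..p n}. \<bar>sample_mean x i n \<omega>\<bar>) > M n})
          \<longlonglongrightarrow> 0 \<and>
        ((\<forall>\<epsilon>>0. small_o_quotient (\<lambda>n. real (p n))
                  (\<lambda>n. (1 / max_tail_prob \<Omega> x p n (M n)) powr \<epsilon>)) \<longrightarrow>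
          (\<lambda>n. 2 * (ln (real (p n)) / ln (1 / max_tail_prob \<Omega> x p n (M n)))) \<longlonglongrightarrow> 0))
     \<and>
     (\<forall>q::real. q \<ge> 1 \<and>
      (\<forall>n\<ge>1. p n \<ge> 2) \<and>
      (\<forall>n. \<forall>i\<in>{1..p n}. \<forall>t\<in>{1..n}. integrable \<Omega> (\<lambda>\<omega>. \<bar>x i t \<omega>\<bar> powr q)) \<and>
      (\<lambda>n. MAX i\<in>{1..p n}. Lq_norm \<Omega> q (sample_mean x i n)) \<in> o(M) \<and>
      small_o_quotient (\<lambda>n. real (p n)) (\<lambda>n. M n powr q / max_moment \<Omega> x p q n)
      \<longrightarrow>
        (\<forall>n\<ge>1. max_moment \<Omega> x p q n < M n powr q \<longrightarrow>
           measure \<Omega> {\<omega> \<in> space \<Omega>. (MAX i\<in>{1..p n}. \<bar>sample_mean x i n \<omega>\<bar>) > M n}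
             \<le> 2 * (ln (real (p n)) / ln (M n powr q / max_moment \<Omega> x p q n))) \<and>
        (\<forall>\<^sub>F n in sequentially. max_moment \<Omega> x p q n < M n powr q) \<and>
        (\<lambda>n. measure \<Omega> {\<omega> \<in> space \<Omega>. (MAX i\<in>{1..p n}. \<bar>sample_mean x i n \<omega>\<bar>) > M n})
          \<longlonglongrightarrow> 0 \<and>
        ((\<forall>\<epsilon>>0. small_o_quotient (\<lambda>n. real (p n))
                  (\<lambda>n. (M n powr q / max_moment \<Omega> x p q n) powr \<epsilon>)) \<longrightarrow>
          (\<lambda>n. 2 * (ln (real (p n)) / ln (M n powr q / max_moment \<Omega> x p q n))) \<longlonglongrightarrow> 0))
     \<and>
     (\<forall>(a::real) (b::real) (\<gamma>::real) (\<phi>::real).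
      a > 0 \<and> b > 0 \<and> \<gamma> > 0 \<and>
      (\<forall>n\<ge>1. \<forall>c>0.
         (MAX i\<in>{1..p n}. measure \<Omega> {\<omega> \<in> space \<Omega>. \<bar>sample_mean x i n \<omega>\<bar> \<ge> c})
           \<le> a * exp (- b * real n powr \<gamma> * c powr \<gamma>)) \<and>
      0 < \<phi> \<and> \<phi> < \<gamma> \<and>
      (\<forall>n\<ge>1. real (p n) > exp 1) \<and>
      (\<lambda>n. ln (real (p n))) \<in> o(\<lambda>n. real n powr \<phi> * M n powr \<phi>)
      \<longrightarrow>
        (\<forall>n\<ge>1.
           measure \<Omega> {\<omega> \<in> space \<Omega>. (MAX i\<in>{1..p n}. \<bar>sample_mean x i n \<omega>\<bar>) \<ge> M n}
             \<le> ln (real (p n)) / (real n powr \<phi> * M n powr \<phi> * ln (ln (real (p n))))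
               + a * (ln (real (p n)) powr (real n powr \<phi> * M n powr \<phi>)
                   / (real n powr \<phi> * M n powr \<phi>
                       * exp (b * real n powr \<gamma> * M n powr \<gamma>) * ln (ln (real (p n)))))) \<and>
        (\<lambda>n. ln (real (p n)) / (real n powr \<phi> * M n powr \<phi> * ln (ln (real (p n))))
               + a * (ln (real (p n)) powr (real n powr \<phi> * M n powr \<phi>)
                   / (real n powr \<phi> * M n powr \<phi>
                       * exp (b * real n powr \<gamma> * M n powr \<gamma>) * ln (ln (real (p n))))))
          \<longlonglongrightarrow> 0)"
proof -
  interpret prob_space \<Omega> by fact
  note x_meas = assms(2) and p_ge = assms(3) and M_pos = assms(4) and M_lim = assms(6)
  let ?u = "\<lambda>n. measure \<Omega> {\<omega> \<in> space \<Omega>. (MAX i\<in>{1..p n}. \<bar>sample_mean x i n \<omega>\<bar>) > M n}"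
  let ?T = "\<lambda>n. max_tail_prob \<Omega> x p n (M n)"
  let ?m = "\<lambda>q n. max_moment \<Omega> x p q n"
  let ?v = "\<lambda>n. measure \<Omega> {\<omega> \<in> space \<Omega>. (MAX i\<in>{1..p n}. \<bar>sample_mean x i n \<omega>\<bar>) \<ge> M n}"
  let ?B = "\<lambda>a b \<gamma> \<phi> n. ln (real (p n)) / (real n powr \<phi> * M n powr \<phi> * ln (ln (real (p n))))
      + a * (ln (real (p n)) powr (real n powr \<phi> * M n powr \<phi>)
          / (real n powr \<phi> * M n powr \<phi>
              * exp (b * real n powr \<gamma> * M n powr \<gamma>) * ln (ln (real (p n)))))"
  have mean_meas: "sample_mean x i n \<in> borel_measurable \<Omega>" if "i \<in> {1..p n}" for i n
    using that x_meas by (intro borel_measurable_sample_mean) auto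
  have union: "?u n \<le> real (p n) * ?T n" if "n \<ge> 1" for n
    using measure_Max_greater_le[of "{1..p n}" "\<lambda>i \<omega>. \<bar>sample_mean x i n \<omega>\<bar>" "M n"]
      p_ge[OF that] mean_meas by (simp add: max_tail_prob_def)
  have T_nonneg: "?T n \<ge> 0" if "n \<ge> 1" for n
    using p_ge[OF that] unfolding max_tail_prob_def by (subst Max_ge_iff) auto
  have p_ge_3: "real (p n) \<ge> 3" if "real (p n) > exp 1" for n
  proof -
    \<comment> \<open>Since \<open>exp 1 \<ge> 2\<close> and \<open>p n\<close> is an integer,
      exceeding \<open>exp 1\<close> already means being at least 3.\<close>
    have "2 < real (p n)" using that exp_ge_add_one_self[of 1] by linarith
    then show ?thesis by simp
  qed

  have part_a: "(\<forall>n\<ge>1. ?T n < 1 \<longrightarrow> ?u n \<le> 2 * (ln (real (p n)) / ln (1 / ?T n))) \<and>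
      (\<forall>\<^sub>F n in sequentially. ?T n < 1) \<and> ?u \<longlonglongrightarrow> 0 \<and>
      ((\<forall>\<epsilon>>0. small_o_quotient (\<lambda>n. real (p n)) (\<lambda>n. (1 / ?T n) powr \<epsilon>)) \<longrightarrow>
        (\<lambda>n. 2 * (ln (real (p n)) / ln (1 / ?T n))) \<longlonglongrightarrow> 0)"
    if p: "\<forall>n\<ge>1. real (p n) > exp 1"
      and small: "small_o_quotient (\<lambda>n. real (p n)) (\<lambda>n. 1 / ?T n)"
  proof -
    have p2: "\<forall>n\<ge>1. real (p n) \<ge> 2"
      using p_ge_3 p by force
    have Q: "\<forall>n\<ge>1. 1 / ?T n \<ge> 0"
      using T_nonneg by simp
    have u: "\<forall>n\<ge>1. ?u n \<le> real (p n) / (1 / ?T n)"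
      using union by simp
    note bounds = ln_ratio_bounds[OF small p2 Q measure_nonneg prob_le_1 u]
    \<comment> \<open>A tail probability below 1 means \<open>Q > 1\<close>, except that the value 0
      gives \<open>Q = 0\<close>, the other admissible case.\<close>
    have "?u n \<le> 2 * (ln (real (p n)) / ln (1 / ?T n))" if "n \<ge> 1" "?T n < 1" for n
      using bounds(1)[OF that(1)] T_nonneg[OF that(1)] that(2)
      by (cases "?T n = 0") auto
    moreover have "\<forall>\<^sub>F n in sequentially. ?T n < 1"
      using bounds(2) by (rule eventually_mono) (auto simp: less_divide_eq_1)
    ultimately show ?thesis
      using bounds(3,4) by blast
  qed

  have part_b: "(\<forall>n\<ge>1. ?m q n < M n powr q \<longrightarrow>
        ?u n \<le> 2 * (ln (real (p n)) / ln (M n powr q / ?m q n))) \<and>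
      (\<forall>\<^sub>F n in sequentially. ?m q n < M n powr q) \<and> ?u \<longlonglongrightarrow> 0 \<and>
      ((\<forall>\<epsilon>>0. small_o_quotient (\<lambda>n. real (p n))
          (\<lambda>n. (M n powr q / ?m q n) powr \<epsilon>)) \<longrightarrow>
        (\<lambda>n. 2 * (ln (real (p n)) / ln (M n powr q / ?m q n))) \<longlonglongrightarrow> 0)"
    if q: "q \<ge> 1" and p: "\<forall>n\<ge>1. p n \<ge> 2"
      and int: "\<forall>n. \<forall>i\<in>{1..p n}. \<forall>t\<in>{1..n}. integrable \<Omega> (\<lambda>\<omega>. \<bar>x i t \<omega>\<bar> powr q)"
      and small: "small_o_quotient (\<lambda>n. real (p n)) (\<lambda>n. M n powr q / ?m q n)"
    for q
  proof -
    have m_nonneg: "?m q n \<ge> 0" if "n \<ge> 1" for n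
      using p_ge[OF that] unfolding max_moment_def by (subst Max_ge_iff) auto
    \<comment> \<open>Markov's inequality, uniform in the coordinate, replaces the tail probability
      in the union bound, so that (b) follows the pattern of (a).\<close>
    have T_le: "?T n \<le> ?m q n / M n powr q" if "n \<ge> 1" for n
    proof -
      have "measure \<Omega> {\<omega> \<in> space \<Omega>. \<bar>sample_mean x i n \<omega>\<bar> > M n} \<le> ?m q n / M n powr q"
        if i: "i \<in> {1..p n}" for i
      proof -
        have "measure \<Omega> {\<omega> \<in> space \<Omega>. \<bar>sample_mean x i n \<omega>\<bar> > M n}
            \<le> (\<integral>\<omega>. \<bar>sample_mean x i n \<omega>\<bar> powr q \<partial>\<Omega>) / M n powr q"
          using \<open>n \<ge> 1\<close> i q M_pos x_meas int
          by (intro measure_abs_greater_le_moment integrable_abs_sample_mean_powr mean_meas) auto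
        also have "\<dots> \<le> ?m q n / M n powr q"
          unfolding max_moment_def using i by (intro divide_right_mono Max_ge) auto
        finally show ?thesis .
      qed
      then show ?thesis
        using p_ge[OF that] unfolding max_tail_prob_def by (subst Max_le_iff) auto
    qed
    have p2: "\<forall>n\<ge>1. real (p n) \<ge> 2"
      using p by auto
    have Q: "\<forall>n\<ge>1. M n powr q / ?m q n \<ge> 0"
      using m_nonneg by simp
    have u: "\<forall>n\<ge>1. ?u n \<le> real (p n) / (M n powr q / ?m q n)"
    proof (intro allI impI)
      fix n :: nat assume that: "n \<ge> 1"
      have "?u n \<le> real (p n) * (?m q n / M n powr q)"
        using union[OF that] mult_left_mono[OF T_le[OF that], of "real (p n)"] by simp
      then show "?u n \<le> real (p n) / (M n powr q / ?m q n)" by simp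
    qed
    note bounds = ln_ratio_bounds[OF small p2 Q measure_nonneg prob_le_1 u]
    have "?u n \<le> 2 * (ln (real (p n)) / ln (M n powr q / ?m q n))"
      if "n \<ge> 1" "?m q n < M n powr q" for n
      using bounds(1)[OF that(1)] m_nonneg[OF that(1)] that(2)
      by (cases "?m q n = 0") auto
    moreover have "\<forall>\<^sub>F n in sequentially. ?m q n < M n powr q"
      using bounds(2) eventually_ge_at_top[of 1]
    proof eventually_elim
      case (elim n)
      then show ?case
        using m_nonneg[of n] M_pos[of n] by (cases "?m q n = 0") (auto simp: field_simps)
    qed
    ultimately show ?thesis
      using bounds(3,4) by blast
  qed

  have part_c: "(\<forall>n\<ge>1. ?v n \<le> ?B a b \<gamma> \<phi> n) \<and> ?B a b \<gamma> \<phi> \<longlonglongrightarrow> 0"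
    if "a > 0" "b > 0" "\<gamma> > 0" "0 < \<phi>" "\<phi> < \<gamma>"
      and tail: "\<forall>n\<ge>1. \<forall>c>0.
         (MAX i\<in>{1..p n}. measure \<Omega> {\<omega> \<in> space \<Omega>. \<bar>sample_mean x i n \<omega>\<bar> \<ge> c})
           \<le> a * exp (- b * real n powr \<gamma> * c powr \<gamma>)"
      and p: "\<forall>n\<ge>1. real (p n) > exp 1"
      and small: "(\<lambda>n. ln (real (p n))) \<in> o(\<lambda>n. real n powr \<phi> * M n powr \<phi>)"
    for a b \<gamma> \<phi>
  proof -
    let ?A = "\<lambda>n. real n powr \<phi> * M n powr \<phi>"
    have A_pos: "?A n > 0" if "n \<ge> 1" for n
      using M_pos[OF that] that by simp
    have "?v n \<le> ?B a b \<gamma> \<phi> n" if n: "n \<ge> 1" for n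
    proof -
      let ?R = "a * exp (- b * real n powr \<gamma> * M n powr \<gamma>)"
      have "?v n \<le> real (p n) * (MAX i\<in>{1..p n}.
          measure \<Omega> {\<omega> \<in> space \<Omega>. \<bar>sample_mean x i n \<omega>\<bar> \<ge> M n})"
        using measure_Max_ge_le[of "{1..p n}" "\<lambda>i \<omega>. \<bar>sample_mean x i n \<omega>\<bar>" "M n"]
          p_ge[OF n] mean_meas by simp
      \<comment> \<open>The tail hypothesis at \<open>c = M n\<close>.\<close>
      also have "\<dots> \<le> real (p n) * ?R"
        using tail n M_pos[OF n] by (intro mult_left_mono) auto
      finally have "?v n \<le> ln (real (p n)) / (?A n * ln (ln (real (p n))))
          + ?R * ln (real (p n)) powr ?A n / (?A n * ln (ln (real (p n))))"
        using p n A_pos[OF n] \<open>a > 0\<close> by (intro le_log_exponential_bound) auto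
      also have "\<dots> = ?B a b \<gamma> \<phi> n"
        by (simp add: exp_minus field_simps)
      finally show ?thesis .
    qed
    moreover have "?B a b \<gamma> \<phi> \<longlonglongrightarrow> 0"
    proof -
      have p3: "\<forall>\<^sub>F n in sequentially. real (p n) \<ge> 3"
        using eventually_ge_at_top[of 1] by eventually_elim (use p p_ge_3 in auto)
      have "filterlim (\<lambda>n. real n * M n) at_top sequentially"
        using filterlim_real_sequentially M_lim by (rule filterlim_at_top_mult_at_top)
      moreover have "filterlim (\<lambda>z. z powr \<phi>) at_top at_top"
        using \<open>\<phi> > 0\<close> by real_asymp
      ultimately have "filterlim (\<lambda>n. (real n * M n) powr \<phi>) at_top sequentially"
        by (rule filterlim_compose[rotated])
      \<comment> \<open>The sign of \<open>M n\<close> is known for \<open>n \<ge> 1\<close>, and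
        there the power of the product splits.\<close>
      moreover have A_eq: "\<forall>\<^sub>F n in sequentially. (real n * M n) powr \<phi> = ?A n"
        using eventually_ge_at_top[of 1]
      proof eventually_elim
        case (elim n)
        then show ?case using M_pos[of n] by (simp add: powr_mult)
      qed
      ultimately have A_lim: "filterlim ?A at_top sequentially"
        using filterlim_cong[OF refl refl A_eq] by simp
      \<comment> \<open>The exponent is \<open>s = \<gamma> / \<phi>\<close>, which exceeds 1
        because \<open>\<phi> < \<gamma>\<close> and turns \<open>?A n\<close> into
        \<open>(n * M n) powr \<gamma>\<close>.\<close>
      have "(\<lambda>n. ln (real (p n)) / (?A n * ln (ln (real (p n))))
          + a * (ln (real (p n)) powr ?A n
              / (?A n * exp (b * ?A n powr (\<gamma> / \<phi>)) * ln (ln (real (p n)))))) \<longlonglongrightarrow> 0"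
        using p3 A_lim small that by (intro log_exponential_bound_tendsto_zero) auto
      moreover have "?A n powr (\<gamma> / \<phi>) = real n powr \<gamma> * M n powr \<gamma>" for n
        using \<open>0 < \<phi>\<close> by (simp add: powr_mult powr_powr)
      ultimately show ?thesis
        by (simp add: mult.assoc)
    qed
    ultimately show ?thesis by blast
  qed

  show ?thesis
    by (rule conjI; (rule conjI)?; ((rule allI)+)?; rule impI; elim conjE;
      (rule part_a | rule part_b | rule part_c); assumption)
qed

end
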